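(* Let $q\in[0,1)$ and let $p$ be a density on $[0,\infty)$ with $q+\int_0^\infty p(x)\,dx=1$, $P(x)=q+\int_0^x p(y)\,dy$, $P^{-1}(z)=\inf\{x\ge 0: P(x)\ge z\}$. For every $r\in[0,1-q]$, the minimum mean caching time (normalized storage cost) over all probabilistic caching policies with hit ratio $r$ equals $\breve s(r)$, where $\breve s$ is the lower convex envelope of the static rate-cost function together with the point $s(0)=0$, namely $$\breve s(r)=\sup\left\{ s_e(r)\ \middle|\ s_e \text{ convex on } [0,1-q],\ s_e(0)=0,\ s_e(\rho)\le \int_0^{P^{-1}(\rho+q)}x\,dP(x)+(1-\rho)P^{-1}(\rho+q)\ \ \forall \rho\in(0,1-q]\right\}.$$
   Context: A content file is requested by a user after a random delay $X$, where $X=-\infty$ (never requested) with probability $q$ and $X$ has density $p$ on $[0,\infty)$. The user has an infinite buffer. With maximum caching time $t\in[0,\infty]$, the file is cached on arrival and removed when it is requested or when it has been cached for time $t$, whichever comes first. For fixed $t$ the hit ratio is $\rho(t)=\int_0^t p(x)\,dx$ and the mean caching time is $$\sigma(t)=\int_0^t x p(x)\,dx+t\left(q+\int_t^\infty p(x)\,dx\right),$$ with $\sigma(\infty)=\lim_{t\to\infty}\sigma(t)\in[0,\infty]$. A probabilistic caching policy is a probability distribution $f$ of the maximum caching time $t$ on $[0,\infty]$, drawn independently of $X$. Its hit ratio is $\mathbb{E}_f[\rho(t)]$ and its mean caching time (the storage cost normalized by the transmission rate) is $\mathbb{E}_f[\sigma(t)]\in[0,\infty]$. A static policy is one with $t$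 deterministic. The static rate-cost function is $s(\rho)=\int_0^{P^{-1}(\rho+q)}x\,dP(x)+(1-\rho)P^{-1}(\rho+q)$ for $\rho\in(0,1-q]$; when $P^{-1}(1)=\infty$, the value at $\rho=1-q$ is understood as $\sigma(\infty)$. Convex functions $s_e$ may take the value $+\infty$. *)

theory Defs
  imports "HOL-Probability.Probability"
begin

text \<open>
  The maximum caching time ranges over \<open>[0,\<infinity>]\<close>, represented by the type \<^typ>\<open>ennreal\<close>.
  Parameters: \<open>q\<close> is the probability of no request, \<open>p\<close> the density of the request delay;
  only the values of \<open>p\<close> on \<open>[0,\<infinity>)\<close> are used.
\<close>

definition hit_ratio :: "(real \<Rightarrow> real) \<Rightarrow> ennreal \<Rightarrow> real" where
  "hit_ratio p t = (LINT x:{x. 0 \<le> x \<and> ennreal x \<le> t}|lborel. p x)"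

definition caching_time_real :: "real \<Rightarrow> (real \<Rightarrow> real) \<Rightarrow> real \<Rightarrow> real" where
  "caching_time_real q p t =
     (LINT x:{0..t}|lborel. x * p x) + t * (q + (LINT x:{t..}|lborel. p x))"

definition caching_time :: "real \<Rightarrow> (real \<Rightarrow> real) \<Rightarrow> ennreal \<Rightarrow> ennreal" where
  "caching_time q p t =
     (if t = \<infinity> then Lim at_top (\<lambda>u. ennreal (caching_time_real q p u))
      else ennreal (caching_time_real q p (enn2real t)))"

definition policies :: "ennreal measure set" where
  "policies = {f. prob_space f \<and> sets f = sets borel}"

definition policy_hit_ratio :: "(real \<Rightarrow> real) \<Rightarrow> ennreal measure \<Rightarrow> real" where
  "policy_hit_ratio p f = (LINT t|f. hit_ratio p t)"

definition policy_caching_time :: "real \<Rightarrow> (real \<Rightarrow> real) \<Rightarrow> ennreal measure \<Rightarrow> ennreal" where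
  "policy_caching_time q p f = (\<integral>\<^sup>+ t. caching_time q p t \<partial>f)"

text \<open>
  For \<open>x < 0\<close> the function below is constantly \<open>q\<close>, so the Stieltjes measure it induces
  is carried by \<open>[0,\<infinity>)\<close> and does not see the event that the file is never requested.
\<close>

definition delay_cdf :: "real \<Rightarrow> (real \<Rightarrow> real) \<Rightarrow> real \<Rightarrow> real" where
  "delay_cdf q p x = q + (LINT y:{0..x}|lborel. p y)"

text \<open>The infimum is taken in \<open>[0,\<infinity>]\<close>, so it is \<open>\<infinity>\<close> when no \<open>x\<close> reaches level \<open>z\<close>.\<close>

definition delay_quantile :: "real \<Rightarrow> (real \<Rightarrow> real) \<Rightarrow> real \<Rightarrow> ennreal" where
  "delay_quantile q p z = Inf {ennreal x |x. 0 \<le> x \<and> z \<le> delay_cdf q p x}"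

text \<open>
  For \<open>\<rho> \<in> (0, 1 - q]\<close> the quantile can be infinite only at \<open>\<rho> = 1 - q\<close>.
\<close>

definition static_rate_cost :: "real \<Rightarrow> (real \<Rightarrow> real) \<Rightarrow> real \<Rightarrow> ennreal" where
  "static_rate_cost q p \<rho> =
     (let a = delay_quantile q p (\<rho> + q) in
      if a = \<infinity> then caching_time q p \<infinity>
      else ennreal ((LINT x:{0..enn2real a}|interval_measure (delay_cdf q p). x)
                     + (1 - \<rho>) * enn2real a))"

text \<open>
  Convexity of functions with values in \<open>(-\<infinity>,\<infinity>]\<close>, which \<^const>\<open>convex_on\<close> (real values only)
  does not cover. In \<^typ>\<open>ereal\<close>, \<open>0 * \<infinity> = 0\<close>.
\<close>

definition ereal_convex_on :: "real set \<Rightarrow> (real \<Rightarrow> ereal) \<Rightarrow> bool" where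
  "ereal_convex_on S g \<longleftrightarrow>
     convex S \<and> (\<forall>x\<in>S. g x \<noteq> -\<infinity>) \<and>
     (\<forall>x\<in>S. \<forall>y\<in>S. \<forall>u\<ge>0. \<forall>v\<ge>0. u + v = 1 \<longrightarrow>
        g (u * x + v * y) \<le> ereal u * g x + ereal v * g y)"

definition convex_rate_cost :: "real \<Rightarrow> (real \<Rightarrow> real) \<Rightarrow> real \<Rightarrow> ereal" where
  "convex_rate_cost q p r =
     Sup {g r |g. ereal_convex_on {0..1 - q} g \<and> g 0 = 0 \<and>
            (\<forall>\<rho>\<in>{0<..1 - q}. g \<rho> \<le> enn2ereal (static_rate_cost q p \<rho>))}"

end

theory Submission imports Defs begin

text \<open>
  Parametrise everything by the caching time \<open>t \<in> [0,\<infinity>]\<close>. The hit ratio \<open>\<rho>(t)\<close> and the mean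
  caching time \<open>\<sigma>(t)\<close> are continuous and nondecreasing on this compact interval, and
  \<open>s(\<rho>) = \<sigma>(P\<^sup>-\<^sup>1(\<rho> + q))\<close> is the least caching time among the static policies of hit ratio \<open>\<rho>\<close>.
  Hence every admissible convex \<open>s\<^sub>e\<close> satisfies \<open>s\<^sub>e(\<rho>(t)) \<le> \<sigma>(t)\<close>, and a supporting line of \<open>s\<^sub>e\<close>
  at \<open>r\<close> gives the lower bound (Jensen).

  For attainment at \<open>0 < r < 1 - q\<close> choose a multiplier \<open>c\<close> for which \<open>\<sigma> - c \<rho>\<close> has minimizers \<open>a, b\<close>
  with \<open>\<rho>(a) \<le> r \<le> \<rho>(b)\<close>. Randomising between \<open>a\<close> and \<open>b\<close> yields hit ratio \<open>r\<close> at cost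
  \<open>L + c r\<close>, where \<open>L\<close> is the minimum, and \<open>x \<mapsto> L + c x\<close>, raised to \<open>0\<close> at \<open>x = 0\<close>, is itself an
  admissible \<open>s\<^sub>e\<close>. At \<open>r = 1 - q\<close> the function vanishing except for the value \<open>s(1 - q)\<close> at
  \<open>1 - q\<close> is admissible.
\<close>

section \<open>Lagrangian minimizers on a compact order\<close>

text \<open>This says that \<open>t\<close> minimizes \<open>S - c * R\<close>. The real terms are
  gathered on one side, so no infinite value is subtracted and points with
  \<open>S u = \<infinity>\<close> impose no condition.\<close>

definition lagrangian_minimizer :: "('a \<Rightarrow> real) \<Rightarrow> ('a \<Rightarrow> ennreal) \<Rightarrow> real \<Rightarrow> 'a \<Rightarrow> bool" where
  "lagrangian_minimizer R S c t \<longleftrightarrow>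
     (\<forall>u. enn2ereal (S t) \<le> enn2ereal (S u) + ereal (c * (R t - R u)))"

text \<open>A complete linear order is compact. The sum stays continuous in \<open>ereal\<close>
  because neither summand takes the value \<open>-\<infinity>\<close>.\<close>

lemma lagrangian_minimizer_exists:
  fixes R :: "'a::{complete_linorder, linorder_topology, second_countable_topology} \<Rightarrow> real"
  assumes R: "continuous_on UNIV R" and S: "continuous_on UNIV S"
  shows "\<exists>t. lagrangian_minimizer R S c t"
proof -
  have "continuous_on UNIV (\<lambda>t. enn2ereal (S t) + ereal (- c * R t))"
    unfolding continuous_on_def
  proof
    fix x
    have "((\<lambda>t. enn2ereal (S t)) \<longlongrightarrow> enn2ereal (S x)) (at x)"
      using S by (auto simp: continuous_on_def)
    moreover have "((\<lambda>t. ereal (- c * R t)) \<longlongrightarrow> ereal (- c * R x)) (at x)"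
      using R by (auto simp: continuous_on_def intro!: tendsto_intros)
    ultimately show "((\<lambda>t. enn2ereal (S t) + ereal (- c * R t)) \<longlongrightarrow>
        enn2ereal (S x) + ereal (- c * R x)) (at x)"
      by (intro tendsto_add_ereal_nonneg) auto
  qed
  then obtain t where t: "\<And>u. enn2ereal (S t) + ereal (- c * R t) \<le> enn2ereal (S u) + ereal (- c * R u)"
    using continuous_attains_inf[OF compact_UNIV] by blast
  have "enn2ereal (S t) \<le> enn2ereal (S u) + ereal (c * (R t - R u))" for u
    using t[of u] by (cases "enn2ereal (S t)"; cases "enn2ereal (S u)") (auto simp: algebra_simps)
  then show ?thesis
    unfolding lagrangian_minimizer_def by blast
qed

text \<open>For each fixed competitor \<open>u\<close> with \<open>S u\<close> finite, both sides of
  the defining inequality converge; otherwise the right side is infinite.\<close>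

lemma lagrangian_minimizer_limit:
  fixes R :: "'a::topological_space \<Rightarrow> real"
  assumes R: "continuous_on UNIV R" and S: "continuous_on UNIV S"
    and M: "\<And>n. lagrangian_minimizer R S (c n) (t n)"
    and c: "c \<longlonglongrightarrow> c'" and t: "t \<longlonglongrightarrow> t'"
  shows "lagrangian_minimizer R S c' t'"
  unfolding lagrangian_minimizer_def
proof
  fix u
  have Rt: "(\<lambda>n. R (t n)) \<longlonglongrightarrow> R t'" and St: "(\<lambda>n. S (t n)) \<longlonglongrightarrow> S t'"
    using continuous_on_tendsto_compose[OF R t] continuous_on_tendsto_compose[OF S t] by auto
  show "enn2ereal (S t') \<le> enn2ereal (S u) + ereal (c' * (R t' - R u))"
  proof (cases "S u")
    case (real s)
    have "(\<lambda>n. ereal (s + c n * (R (t n) - R u))) \<longlonglongrightarrow> ereal (s + c' * (R t' - R u))"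
      by (intro tendsto_intros Rt c)
    moreover have "(\<lambda>n. enn2ereal (S (t n))) \<longlonglongrightarrow> enn2ereal (S t')"
      using St by simp
    moreover have "enn2ereal (S (t n)) \<le> ereal (s + c n * (R (t n) - R u))" for n
      using M[of n] real unfolding lagrangian_minimizer_def by (auto dest!: spec[of _ u] simp: enn2ereal_ennreal)
    ultimately have "enn2ereal (S t') \<le> ereal (s + c' * (R t' - R u))"
      using LIMSEQ_le by blast
    then show ?thesis
      using real by (simp add: enn2ereal_ennreal)
  qed simp
qed

text \<open>Raising \<open>c\<close> rewards large values of \<open>R\<close>. Comparison with
  \<open>t0\<close> bounds from below the multipliers that have a minimizer with
  \<open>r \<le> R t\<close>; comparison with \<open>t1\<close> shows that there are some. At the
  threshold, compactness yields minimizers on both sides of \<open>r\<close>, possibly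
  distinct.\<close>

lemma bracketing_lagrangian_minimizers:
  fixes R :: "'a::{complete_linorder, linorder_topology, second_countable_topology} \<Rightarrow> real"
  assumes R: "continuous_on UNIV R" and S: "continuous_on UNIV S"
    and t0: "S t0 < \<infinity>" "R t0 < r" and t1: "S t1 < \<infinity>" "r < R t1"
  obtains c a b where "lagrangian_minimizer R S c a" "lagrangian_minimizer R S c b" "R a \<le> r" "r \<le> R b"
proof -
  obtain s0 s1 where s: "0 \<le> s0" "S t0 = ennreal s0" "0 \<le> s1" "S t1 = ennreal s1"
    using t0 t1 by (cases "S t0"; cases "S t1") auto
  \<comment> \<open>At \<open>c = Inf C\<close>, multipliers approaching from above give \<open>b\<close> and from below give \<open>a\<close>.\<close>
  define C where "C = {c. \<exists>t. lagrangian_minimizer R S c t \<and> r \<le> R t}"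
  \<comment> \<open>From \<open>0 \<le> S t \<le> s0 + c * (R t - R t0)\<close>: for negative
    \<open>c\<close> the factor may be shrunk to \<open>r - R t0\<close>, since
    \<open>r \<le> R t\<close>.\<close>
  have below: "- s0 / (r - R t0) \<le> c" if c: "c \<in> C" for c
  proof -
    obtain t where t: "lagrangian_minimizer R S c t" "r \<le> R t"
      using c unfolding C_def mem_Collect_eq by blast
    have "0 \<le> enn2ereal (S t)" by simp
    also have "\<dots> \<le> ereal (s0 + c * (R t - R t0))"
      using t(1) s unfolding lagrangian_minimizer_def
      by (auto dest!: spec[of _ t0] simp: enn2ereal_ennreal)
    finally have "- s0 \<le> c * (R t - R t0)" by simp
    show ?thesis
    proof (cases "0 \<le> c")
      case True
      then show ?thesis using s t0 by (smt (verit) divide_nonpos_pos)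
    next
      case False
      then have "c * (R t - R t0) \<le> c * (r - R t0)"
        using t by (intro mult_left_mono_neg) auto
      then have "- s0 \<le> c * (r - R t0)"
        using \<open>- s0 \<le> c * (R t - R t0)\<close> by linarith
      then show ?thesis
        using pos_divide_le_eq[of "r - R t0" "- s0" c] t0 by simp
    qed
  qed
  have "C \<noteq> {}"
  proof -
    \<comment> \<open>With this value a minimizer having \<open>R t < r\<close> would satisfy
      \<open>- s1 \<le> c * (R t - R t1) \<le> - (s1 + 1)\<close>.\<close>
    define c where "c = (s1 + 1) / (R t1 - r)"
    obtain t where t: "lagrangian_minimizer R S c t"
      using lagrangian_minimizer_exists[OF R S] by blast
    have "0 \<le> enn2ereal (S t)" by simp
    also have "\<dots> \<le> ereal (s1 + c * (R t - R t1))"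
      using t s unfolding lagrangian_minimizer_def
      by (auto dest!: spec[of _ t1] simp: enn2ereal_ennreal)
    finally have 1: "- s1 \<le> c * (R t - R t1)" by simp
    have "r \<le> R t"
    proof (rule ccontr)
      assume "\<not> r \<le> R t"
      then have "c * (R t - R t1) \<le> c * (r - R t1)"
        using s t1 by (intro mult_left_mono) (auto simp: c_def)
      also have "\<dots> = - (s1 + 1)"
        using t1 by (simp add: c_def field_simps)
      finally show False using 1 by simp
    qed
    then show ?thesis using t by (auto simp: C_def)
  qed
  define c where "c = Inf C"
  have bdd: "bdd_below C"
    using below by (rule bdd_belowI)
  have "\<exists>t. lagrangian_minimizer R S c t \<and> r \<le> R t"
  proof -
    have "\<exists>d\<in>C. d < c + 1 / Suc n" for n
      using cInf_lessD[OF \<open>C \<noteq> {}\<close>, of "c + 1 / Suc n"] by (auto simp: c_def)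
    then obtain d where d: "\<And>n. d n \<in> C" "\<And>n. d n < c + 1 / Suc n"
      by metis
    have "d \<longlonglongrightarrow> c"
    proof (rule tendsto_sandwich)
      show "\<forall>\<^sub>F n in sequentially. c \<le> d n"
        using cInf_lower[OF d(1) bdd] by (simp add: c_def)
      show "\<forall>\<^sub>F n in sequentially. d n \<le> c + 1 / Suc n"
        using less_imp_le[OF d(2)] by simp
      show "(\<lambda>n. c + 1 / real (Suc n)) \<longlonglongrightarrow> c"
        using tendsto_add[OF tendsto_const LIMSEQ_inverse_real_of_nat, of c]
        by (simp add: inverse_eq_divide)
    qed simp
    obtain t where t: "\<And>n. lagrangian_minimizer R S (d n) (t n)" "\<And>n. r \<le> R (t n)"
      using d(1) unfolding C_def mem_Collect_eq by metis
    obtain l h where h: "strict_mono (h :: nat \<Rightarrow> nat)" "(t \<circ> h) \<longlonglongrightarrow> l"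
      using compact_complete_linorder by blast
    have "lagrangian_minimizer R S c l"
      using lagrangian_minimizer_limit[OF R S, of "d \<circ> h" "t \<circ> h"] t h
        LIMSEQ_subseq_LIMSEQ[OF \<open>d \<longlonglongrightarrow> c\<close> h(1)] by auto
    moreover have "r \<le> R l"
      using continuous_on_tendsto_compose[OF R h(2)] t(2) by (intro LIMSEQ_le_const) auto
    ultimately show ?thesis by blast
  qed
  then obtain b where b: "lagrangian_minimizer R S c b" "r \<le> R b" by blast
  have "\<exists>t. lagrangian_minimizer R S c t \<and> R t \<le> r"
  proof -
    define d where "d n = c - 1 / Suc n" for n
    have "d \<longlonglongrightarrow> c"
      using tendsto_diff[OF tendsto_const LIMSEQ_inverse_real_of_nat, of c]
      by (simp add: inverse_eq_divide d_def[abs_def])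
    obtain t where t: "\<And>n. lagrangian_minimizer R S (d n) (t n)"
      using choice[of "\<lambda>n t. lagrangian_minimizer R S (d n) t"] lagrangian_minimizer_exists[OF R S]
      by blast
    \<comment> \<open>Below \<open>Inf C\<close> no minimizer has \<open>r \<le> R t\<close>, so any
      choice of minimizers stays on the lower side.\<close>
    have d: "d n \<notin> C" for n
      using cInf_lower[OF _ bdd, of "d n"] by (auto simp: d_def c_def)
    have tr: "R (t n) \<le> r" for n
      using t[of n] d[of n] unfolding C_def mem_Collect_eq by (meson linear)
    obtain l h where h: "strict_mono (h :: nat \<Rightarrow> nat)" "(t \<circ> h) \<longlonglongrightarrow> l"
      using compact_complete_linorder by blast
    have "lagrangian_minimizer R S c l"
      using lagrangian_minimizer_limit[OF R S, of "d \<circ> h" "t \<circ> h"] t h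
        LIMSEQ_subseq_LIMSEQ[OF \<open>d \<longlonglongrightarrow> c\<close> h(1)] by auto
    moreover have "R l \<le> r"
      using continuous_on_tendsto_compose[OF R h(2)] tr by (intro LIMSEQ_le_const2) auto
    ultimately show ?thesis by blast
  qed
  then obtain a where "lagrangian_minimizer R S c a" "R a \<le> r" by blast
  with b that show thesis by blast
qed

section \<open>Extended-real convex functions and a Jensen-type estimate\<close>

text \<open>On its finiteness domain \<open>I\<close>, \<open>g\<close> is an ordinary real convex
  function, and \<open>r\<close> is interior to \<open>I\<close>. The slope is the infimum of the
  difference quotients to the right of \<open>r\<close>. Where \<open>g\<close> is infinite,
  possibly at \<open>m\<close>, the bound is trivial.\<close>

lemma ereal_convex_on_supporting_line:
  assumes g: "ereal_convex_on {0..m} g" and r: "0 < r" "r < m"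
    and fin: "\<And>x. 0 \<le> x \<Longrightarrow> x < m \<Longrightarrow> g x < \<infinity>"
  obtains c where "\<And>x. x \<in> {0..m} \<Longrightarrow> ereal (real_of_ereal (g r) + c * (x - r)) \<le> g x"
proof -
  define I where "I = {x \<in> {0..m}. g x < \<infinity>}"
  define G where "G x = real_of_ereal (g x)" for x
  have gG: "g x = ereal (G x)" if "x \<in> I" for x
    using that g unfolding I_def G_def ereal_convex_on_def
    by (cases "g x") auto
  have conv: "g (u * x + v * y) \<le> ereal (u * G x + v * G y)"
    if "x \<in> I" "y \<in> I" "0 \<le> u" "0 \<le> v" "u + v = 1" for x y u v
  proof -
    have "g (u * x + v * y) \<le> ereal u * g x + ereal v * g y"
      using g that unfolding ereal_convex_on_def I_def by blast
    then show ?thesis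
      using gG that by simp
  qed
  have mem: "u * x + v * y \<in> I" if "x \<in> I" "y \<in> I" "0 \<le> u" "0 \<le> v" "u + v = 1" for x y u v
  proof -
    have "u * x + v * y \<in> {0..m}"
      using convexD[OF convex_real_interval(5)[of 0 m], of x y u v] that by (auto simp: I_def)
    moreover have "g (u * x + v * y) < \<infinity>"
      using conv[OF that] by (rule le_less_trans) simp
    ultimately show ?thesis by (simp add: I_def)
  qed
  have "convex I"
    using mem by (auto intro!: convexI)
  have "convex_on I G"
  proof (rule convex_onI)
    fix t x y :: real assume *: "0 < t" "t < 1" "x \<in> I" "y \<in> I"
    then have "(1 - t) * x + t * y \<in> I"
      by (intro mem) auto
    then show "G ((1 - t) *\<^sub>R x + t *\<^sub>R y) \<le> (1 - t) * G x + t * G y"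
      using conv[of x y "1 - t" t] * gG by auto
  qed fact
  moreover have "r \<in> interior I"
  proof (rule interiorI[of "{0<..<m}"])
    show "{0<..<m} \<subseteq> I" using fin by (auto simp: I_def)
  qed (use r in auto)
  ultimately have line: "G r + Inf ((\<lambda>t. (G r - G t) / (r - t)) ` ({r<..} \<inter> I)) * (y - r) \<le> G y"
    if "y \<in> I" for y
    using convex_le_Inf_differential[of I G r y] that by simp
  define c where "c = Inf ((\<lambda>t. (G r - G t) / (r - t)) ` ({r<..} \<inter> I))"
  show thesis
  proof (rule that[of c])
    fix x assume x: "x \<in> {0..m}"
    show "ereal (real_of_ereal (g r) + c * (x - r)) \<le> g x"
    proof (cases "g x < \<infinity>")
      case True
      then have "x \<in> I" using x by (simp add: I_def)
      then show ?thesis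
        using line[of x] gG[of x] unfolding c_def[symmetric] G_def[symmetric] by simp
    qed simp
  qed
qed

text \<open>Since \<open>L \<le> 0\<close>, the value \<open>0\<close> at the origin lies above the
  line, so the right side of the convexity inequality only grows. A combination of points of
  \<open>{0..m}\<close> vanishes only if all points of positive weight do.\<close>

lemma affine_minorant_convex:
  assumes "L \<le> (0::real)"
  shows "ereal_convex_on {0..m} (\<lambda>x. if x = 0 then 0 else ereal (L + c * x))"
proof -
  define G where "G x = (if x = 0 then 0 else L + c * x)" for x
  have "G (u * x + v * y) \<le> u * G x + v * G y"
    if "0 \<le> x" "0 \<le> y" "0 \<le> u" "0 \<le> v" "u + v = 1" for x y u v
  proof (cases "u * x + v * y = 0")
    case True
    then have "u * x = 0" "v * y = 0"
      using that by (auto simp: add_nonneg_eq_0_iff)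
    then have "u * G x = 0" "v * G y = 0" by (auto simp: G_def)
    then have "u * G x + v * G y = 0" by linarith
    moreover have "G (u * x + v * y) = 0" using True by (simp add: G_def)
    ultimately show ?thesis by simp
  next
    case False
    have "L + c * z \<le> G z" for z
      using assms by (simp add: G_def)
    then have "u * (L + c * x) + v * (L + c * y) \<le> u * G x + v * G y"
      using that by (intro add_mono mult_left_mono) auto
    moreover have "u * (L + c * x) + v * (L + c * y) = (u + v) * L + c * (u * x + v * y)"
      by (simp add: algebra_simps)
    ultimately show ?thesis using False that by (simp add: G_def)
  qed
  then have "ereal_convex_on {0..m} (\<lambda>x. ereal (G x))"
    unfolding ereal_convex_on_def by auto
  moreover have "(\<lambda>x. ereal (G x)) = (\<lambda>x. if x = 0 then 0 else ereal (L + c * x))"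
    by (auto simp: G_def zero_ereal_def)
  ultimately show ?thesis by simp
qed

text \<open>The endpoint \<open>m\<close> is extreme: a combination equals \<open>m\<close> only if
  every point of positive weight does. The value \<open>s = \<infinity>\<close> is allowed.\<close>

lemma endpoint_jump_convex:
  assumes "0 \<le> (s :: ereal)"
  shows "ereal_convex_on {0..m} (\<lambda>x. if x = m then s else 0)"
proof -
  define g where "g x = (if x = m then s else 0)" for x
  have g: "0 \<le> g x" for x using assms by (simp add: g_def)
  have "g (u * x + v * y) \<le> ereal u * g x + ereal v * g y"
    if "x \<le> m" "y \<le> m" "0 \<le> u" "0 \<le> v" "u + v = 1" for x y u v
  proof (cases "u * x + v * y = m")
    case True
    have "u * (m - x) + v * (m - y) = (u + v) * m - (u * x + v * y)"
      by (simp add: algebra_simps)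
    then have "u * (m - x) = 0" "v * (m - y) = 0"
      using True that add_nonneg_eq_0_iff[of "u * (m - x)" "v * (m - y)"] by auto
    then have "ereal u * g x = ereal u * s" "ereal v * g y = ereal v * s"
      by (auto simp: g_def)
    then have "ereal u * g x + ereal v * g y = ereal (u + v) * s"
      using that by (simp add: ereal_left_distrib[symmetric])
    then show ?thesis using True that assms by (simp add: g_def one_ereal_def[symmetric])
  next
    case False
    then have "g (u * x + v * y) = 0" by (simp add: g_def)
    then show ?thesis using that g by simp
  qed
  then have "ereal_convex_on {0..m} g"
    unfolding ereal_convex_on_def using g by fastforce
  then show ?thesis by (simp add: g_def[abs_def])
qed

text \<open>The function \<open>h\<close> may be negative, but \<open>ennreal\<close> truncates at
  \<open>0\<close>, so the pointwise bound already holds for its positive part.\<close>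

lemma integral_le_nn_integral:
  assumes "integrable f h" and "\<And>t. ennreal (h t) \<le> S t"
  shows "ennreal (LINT t|f. h t) \<le> (\<integral>\<^sup>+ t. S t \<partial>f)"
proof -
  have "ennreal (LINT t|f. h t) \<le> ennreal (LINT t|f. max 0 (h t))"
    using assms(1) by (intro ennreal_leI integral_mono) auto
  also have "\<dots> = (\<integral>\<^sup>+ t. ennreal (max 0 (h t)) \<partial>f)"
    using assms(1) by (intro nn_integral_eq_integral[symmetric]) auto
  also have "\<dots> \<le> (\<integral>\<^sup>+ t. S t \<partial>f)"
    using assms(2) by (intro nn_integral_mono) (auto simp: max_def not_le ennreal_neg)
  finally show ?thesis .
qed

section \<open>The hit ratio as a function of the caching time\<close>

locale request_delay =
  fixes q :: real and p :: "real \<Rightarrow> real"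
  assumes q: "0 \<le> q" "q < 1"
    and p_nonneg: "\<And>x. 0 \<le> x \<Longrightarrow> 0 \<le> p x"
    and p_integrable: "set_integrable lborel {0..} p"
    and p_total: "q + (LINT x:{0..}|lborel. p x) = 1"
begin

text \<open>Nothing is known about \<open>p\<close> on the negative reals; the extension by zero
  allows integration over the whole line.\<close>

definition w :: "real \<Rightarrow> real" where
  "w x = indicator {0..} x * p x"

lemma w_nonneg: "0 \<le> w x"
  using p_nonneg by (auto simp: w_def indicator_def)

lemma w_neg: "x < 0 \<Longrightarrow> w x = 0"
  by (simp add: w_def)

lemma w_integrable [simp]: "integrable lborel w"
  using p_integrable by (simp add: set_integrable_def w_def[abs_def])

lemma w_measurable [measurable]: "w \<in> borel_measurable borel"
  using borel_measurable_integrable[OF w_integrable] by simp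

lemma w_total: "(LINT x|lborel. w x) = 1 - q"
  using p_total by (simp add: set_lebesgue_integral_def w_def[abs_def])

lemma w_integrable_indicator [simp]:
  "A \<in> sets borel \<Longrightarrow> integrable lborel (\<lambda>x. indicator A x * w x)"
  using integrable_mult_indicator[of A lborel w] by simp

text \<open>Negative \<open>x\<close> also satisfy \<open>ennreal x \<le> t\<close>, which is
  harmless because \<open>w\<close> vanishes there.\<close>

lemma hit_ratio_eq: "hit_ratio p t = (LINT x|lborel. indicator {x. ennreal x \<le> t} x * w x)"
  unfolding hit_ratio_def set_lebesgue_integral_def
  by (intro Bochner_Integration.integral_cong) (auto simp: w_def indicator_def)

lemma hit_ratio_ennreal:
  "0 \<le> t \<Longrightarrow> hit_ratio p (ennreal t) = (LINT x|lborel. indicator {..t} x * w x)"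
  unfolding hit_ratio_eq by (intro Bochner_Integration.integral_cong) (auto simp: indicator_def)

lemma hit_ratio_mono: "mono (hit_ratio p)"
  unfolding hit_ratio_eq
  by (intro monoI integral_mono w_integrable_indicator mult_right_mono w_nonneg)
     (auto simp: indicator_def)

lemma hit_ratio_top: "hit_ratio p \<infinity> = 1 - q"
  using w_total by (simp add: hit_ratio_eq)

lemma hit_ratio_zero: "hit_ratio p 0 = 0"
proof -
  have "(LINT x|lborel. indicator {x. ennreal x \<le> 0} x * w x) = (LINT x|(lborel :: real measure). 0)"
  proof (intro integral_cong_AE)
    show "AE x in lborel. indicator {x. ennreal x \<le> 0} x * w x = 0"
      using AE_lborel_singleton[of "0::real"]
      by eventually_elim (auto simp: indicator_def w_neg ennreal_eq_0_iff)
  qed auto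
  then show ?thesis by (simp add: hit_ratio_eq)
qed

lemma hit_ratio_nonneg: "0 \<le> hit_ratio p t"
  using monoD[OF hit_ratio_mono, of 0 t] by (simp add: hit_ratio_zero)

lemma hit_ratio_le: "hit_ratio p t \<le> 1 - q"
  using monoD[OF hit_ratio_mono, of t \<infinity>] hit_ratio_top by simp

text \<open>Dominated convergence with bound \<open>w\<close>: the indicators converge except
  possibly at the limiting time itself, a null set. For \<open>a = \<infinity>\<close> the discarded
  point is \<open>0\<close>, again null.\<close>

lemma hit_ratio_continuous: "continuous_on UNIV (hit_ratio p)"
proof (rule continuous_on_sequentiallyI)
  fix u :: "nat \<Rightarrow> ennreal" and a
  assume u: "u \<longlonglongrightarrow> a"
  show "(\<lambda>n. hit_ratio p (u n)) \<longlonglongrightarrow> hit_ratio p a"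
    unfolding hit_ratio_eq
  proof (rule integral_dominated_convergence[where w = w])
    show "AE x in lborel. (\<lambda>n. indicator {x. ennreal x \<le> u n} x * w x)
        \<longlonglongrightarrow> indicator {x. ennreal x \<le> a} x * w x"
      using AE_lborel_singleton[of "enn2real a"]
    proof eventually_elim
      fix x assume x: "x \<noteq> enn2real a"
      show "(\<lambda>n. indicator {x. ennreal x \<le> u n} x * w x) \<longlonglongrightarrow> indicator {x. ennreal x \<le> a} x * w x"
      proof (cases "x < 0")
        case False
        then have "ennreal x \<noteq> a" using x by auto
        then consider "ennreal x < a" | "a < ennreal x" by (meson neqE)
        then have "\<forall>\<^sub>F n in sequentially.
            indicator {x. ennreal x \<le> u n} x * w x = indicator {x. ennreal x \<le> a} x * w x"
        proof cases
          case 1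
          show ?thesis
            using order_tendstoD(1)[OF u 1] by eventually_elim (use 1 in \<open>auto simp: indicator_def\<close>)
        next
          case 2
          show ?thesis
            using order_tendstoD(2)[OF u 2] by eventually_elim (use 2 in \<open>auto simp: indicator_def\<close>)
        qed
        then show ?thesis by (rule tendsto_eventually)
      qed (simp add: w_neg)
    qed
    show "AE x in lborel. norm (indicator {x. ennreal x \<le> u n} x * w x) \<le> w x" for n
      using w_nonneg by (intro AE_I2) (auto simp: indicator_def)
  qed auto
qed

section \<open>The mean caching time\<close>

lemma delay_cdf_eq: "delay_cdf q p x = q + (LINT y|lborel. indicator {..x} y * w y)"
  unfolding delay_cdf_def set_lebesgue_integral_def
  by (intro arg_cong2[where f = "(+)"] Bochner_Integration.integral_cong)
     (auto simp: w_def indicator_def)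

lemma tail_integral:
  assumes "0 \<le> t"
  shows "(LINT x:{t..}|lborel. p x) = 1 - q - hit_ratio p (ennreal t)"
proof -
  have "(LINT x:{t..}|lborel. p x) = (LINT x|lborel. indicator {t..} x * w x)"
    unfolding set_lebesgue_integral_def using assms
    by (intro Bochner_Integration.integral_cong) (auto simp: w_def indicator_def)
  also have "\<dots> = (LINT x|lborel. w x - indicator {..t} x * w x)"
  proof (rule integral_cong_AE)
    show "AE x in lborel. indicator {t..} x * w x = w x - indicator {..t} x * w x"
      using AE_lborel_singleton[of t] by eventually_elim (auto simp: indicator_def)
  qed auto
  also have "\<dots> = 1 - q - hit_ratio p (ennreal t)"
    using assms w_total by (simp add: hit_ratio_ennreal)
  finally show ?thesis .
qed

lemma integrable_truncated [simp]:
  assumes "0 \<le> t"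
  shows "integrable lborel (\<lambda>x. x * (indicator {..t} x * w x))"
proof (rule Bochner_Integration.integrable_bound[of lborel "\<lambda>x. t * w x"])
  show "AE x in lborel. norm (x * (indicator {..t} x * w x)) \<le> norm (t * w x)"
  proof (rule AE_I2)
    fix x show "norm (x * (indicator {..t} x * w x)) \<le> norm (t * w x)"
      using assms w_nonneg[of x] w_neg[of x]
      by (cases "x < 0") (auto simp: indicator_def abs_mult intro!: mult_right_mono)
  qed
qed auto

lemma min_weight_eq:
  "min x t * w x = x * (indicator {..t} x * w x) + t * w x - t * (indicator {..t} x * w x)"
  by (auto simp: indicator_def min_def)

lemma integrable_min: "0 \<le> t \<Longrightarrow> integrable lborel (\<lambda>x. min x t * w x)"
  unfolding min_weight_eq by simp

lemma truncated_integral: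
  "(LINT x:{0..t}|lborel. x * p x) = (LINT x|lborel. x * (indicator {..t} x * w x))"
  unfolding set_lebesgue_integral_def
  by (intro Bochner_Integration.integral_cong) (auto simp: w_def indicator_def)

text \<open>A requested file stays for \<open>min x t\<close>, an unrequested one for
  \<open>t\<close>. Monotonicity and the Lipschitz bound are read off from this form.\<close>

lemma caching_time_real_eq:
  assumes "0 \<le> t"
  shows "caching_time_real q p t = t * q + (LINT x|lborel. min x t * w x)"
proof -
  have "(LINT x|lborel. min x t * w x) =
      (LINT x|lborel. x * (indicator {..t} x * w x)) + t * (1 - q) - t * hit_ratio p (ennreal t)"
    unfolding min_weight_eq using assms w_total by (simp add: hit_ratio_ennreal)
  then show ?thesis
    unfolding caching_time_real_def tail_integral[OF assms] truncated_integral
    by (simp add: algebra_simps)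
qed

lemma caching_time_real_zero: "caching_time_real q p 0 = 0"
proof -
  have "(LINT x|lborel. min x 0 * w x) = (LINT x|(lborel :: real measure). 0)"
    by (intro Bochner_Integration.integral_cong) (auto simp: min_def w_def)
  then show ?thesis by (simp add: caching_time_real_eq)
qed

lemma caching_time_real_mono:
  assumes "0 \<le> s" "s \<le> t"
  shows "caching_time_real q p s \<le> caching_time_real q p t"
proof -
  have "(LINT x|lborel. min x s * w x) \<le> (LINT x|lborel. min x t * w x)"
    using assms w_nonneg by (intro integral_mono integrable_min mult_right_mono) auto
  then show ?thesis
    using assms q by (auto simp: caching_time_real_eq intro!: add_mono mult_right_mono)
qed

text \<open>Use \<open>min x t \<le> min x s + (t - s)\<close> and the total mass
  \<open>q + (1 - q) = 1\<close>. With monotonicity this gives Lipschitz constant 1.\<close>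

lemma caching_time_real_growth:
  assumes "0 \<le> s" "s \<le> t"
  shows "caching_time_real q p t \<le> caching_time_real q p s + (t - s)"
proof -
  have "(LINT x|lborel. min x t * w x) \<le> (LINT x|lborel. min x s * w x + (t - s) * w x)"
  proof (intro integral_mono)
    fix x
    have "min x t * w x \<le> (min x s + (t - s)) * w x"
      using assms w_nonneg by (intro mult_right_mono) auto
    then show "min x t * w x \<le> min x s * w x + (t - s) * w x"
      by (simp add: algebra_simps)
  qed (use assms in \<open>auto intro!: integrable_min\<close>)
  also have "\<dots> = (LINT x|lborel. min x s * w x) + (t - s) * (1 - q)"
    using assms by (simp add: integrable_min w_total)
  finally show ?thesis
    using assms by (simp add: caching_time_real_eq algebra_simps)
qed

lemma caching_time_real_continuous: "continuous_on {0..} (caching_time_real q p)"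
proof (rule lipschitz_on_continuous_on[of 1])
  show "1-lipschitz_on {0..} (caching_time_real q p)"
  proof (rule lipschitz_onI)
    fix x y :: real assume "x \<in> {0..}" "y \<in> {0..}"
    then show "dist (caching_time_real q p x) (caching_time_real q p y) \<le> 1 * dist x y"
      using caching_time_real_mono[of x y] caching_time_real_growth[of x y]
        caching_time_real_mono[of y x] caching_time_real_growth[of y x]
      by (cases "x \<le> y") (auto simp: dist_real_def)
  qed simp
qed

lemma caching_time_ennreal:
  "0 \<le> t \<Longrightarrow> caching_time q p (ennreal t) = ennreal (caching_time_real q p t)"
  by (simp add: caching_time_def)

lemma caching_time_zero: "caching_time q p 0 = 0"
  using caching_time_ennreal[of 0] caching_time_real_zero by simp

lemma caching_time_finite: "t < \<infinity> \<Longrightarrow> caching_time q p t < \<infinity>"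
  by (cases t) (auto simp: caching_time_ennreal)

text \<open>By monotonicity on nonnegative times, the limit in the definition exists in
  \<open>ennreal\<close> and is a supremum.\<close>

lemma caching_time_top:
  "caching_time q p \<infinity> = (SUP u\<in>{0..}. ennreal (caching_time_real q p u))" (is "_ = ?S")
proof -
  have "((\<lambda>u. ennreal (caching_time_real q p u)) \<longlongrightarrow> ?S) at_top"
  proof (rule order_tendstoI)
    fix a assume "a < ?S"
    then obtain u where u: "0 \<le> u" "a < ennreal (caching_time_real q p u)"
      by (auto simp: less_SUP_iff)
    show "\<forall>\<^sub>F v in at_top. a < ennreal (caching_time_real q p v)"
      using eventually_ge_at_top[of u]
      by eventually_elim
         (use u caching_time_real_mono in \<open>auto intro: less_le_trans ennreal_leI\<close>)
  next
    fix a assume a: "?S < a"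
    show "\<forall>\<^sub>F v in at_top. ennreal (caching_time_real q p v) < a"
      using eventually_ge_at_top[of 0]
      by eventually_elim (rule le_less_trans[OF SUP_upper a], simp)
  qed
  then show ?thesis
    by (simp add: caching_time_def tendsto_Lim)
qed

lemma caching_time_mono: "mono (caching_time q p)"
proof (rule monoI)
  fix s t :: ennreal assume "s \<le> t"
  then show "caching_time q p s \<le> caching_time q p t"
    by (cases s; cases t)
       (auto simp: caching_time_ennreal caching_time_top[unfolded infinity_ennreal_def] top_unique
             intro!: ennreal_leI caching_time_real_mono SUP_upper)
qed

text \<open>Near a finite time all times are finite and the real function is Lipschitz. At
  \<open>\<infinity>\<close> the supremum formula gives the lower estimate and monotonicity the
  upper one.\<close>

lemma caching_time_continuous: "continuous_on UNIV (caching_time q p)"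
  unfolding continuous_on_def
proof
  fix x :: ennreal
  show "(caching_time q p \<longlongrightarrow> caching_time q p x) (at x)"
  proof (cases x)
    case (real s)
    have fin: "\<forall>\<^sub>F t in at x. t < \<infinity>"
      using order_tendstoD(2)[OF tendsto_ident_at[of x UNIV], of \<infinity>] real by simp
    have "((\<lambda>t. enn2real t) \<longlongrightarrow> s) (at x)"
      using real by (intro tendsto_enn2real) auto
    then have "((\<lambda>t. caching_time_real q p (enn2real t)) \<longlongrightarrow> caching_time_real q p s) (at x)"
      using real by (intro continuous_on_tendsto_compose[OF caching_time_real_continuous]) auto
    then have "((\<lambda>t. ennreal (caching_time_real q p (enn2real t))) \<longlongrightarrow> caching_time q p x) (at x)"
      using real by (auto simp: caching_time_ennreal)
    moreover have "\<forall>\<^sub>F t in at x. ennreal (caching_time_real q p (enn2real t)) = caching_time q p t"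
      using fin by eventually_elim (auto simp: caching_time_def)
    ultimately show ?thesis
      by (rule Lim_transform_eventually)
  next
    case top
    show ?thesis
    proof (rule order_tendstoI)
      fix a assume "a < caching_time q p x"
      then obtain u where u: "0 \<le> u" "a < ennreal (caching_time_real q p u)"
        using top caching_time_top by (auto simp: less_SUP_iff)
      have "\<forall>\<^sub>F t in at x. ennreal u < t"
        using order_tendstoD(1)[OF tendsto_ident_at[of x UNIV], of "ennreal u"] top by simp
      then show "\<forall>\<^sub>F t in at x. a < caching_time q p t"
      proof eventually_elim
        case (elim t)
        then show ?case
          using u monoD[OF caching_time_mono, of "ennreal u" t]
          by (auto simp: caching_time_ennreal intro: less_le_trans)
      qed
    next
      fix a assume "caching_time q p x < a"
      then show "\<forall>\<^sub>F t in at x. caching_time q p t < a"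
        using top monoD[OF caching_time_mono, of _ x] by (intro always_eventually allI) (auto intro: le_less_trans)
    qed
  qed
qed

section \<open>Stieltjes measure, quantile and static rate-cost function\<close>

text \<open>The constant \<open>q\<close> cancels in increments, so both measures agree on half-open
  intervals, which generate the Borel sets.\<close>

lemma interval_measure_delay_cdf:
  "interval_measure (delay_cdf q p) = density lborel (\<lambda>x. ennreal (w x))"
proof -
  define M where "M = density lborel (\<lambda>x. ennreal (w x))"
  have emeasure_M: "emeasure M A = ennreal (LINT x|lborel. indicator A x * w x)"
    if "A \<in> sets borel" for A
  proof -
    have "emeasure M A = (\<integral>\<^sup>+ x. ennreal (indicator A x * w x) \<partial>lborel)"
      unfolding M_def using that
      by (subst emeasure_density) (auto intro!: nn_integral_cong simp: indicator_def)
    also have "\<dots> = ennreal (LINT x|lborel. indicator A x * w x)"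
      using that w_nonneg by (intro nn_integral_eq_integral) auto
    finally show ?thesis .
  qed
  interpret M: finite_borel_measure M
  proof (intro finite_borel_measure.intro finite_measureI finite_borel_measure_axioms.intro)
    have "space M = UNIV" by (simp add: M_def)
    then show "emeasure M (space M) \<noteq> \<infinity>" by (simp add: emeasure_M)
    show "sets M = sets borel" by (simp add: M_def)
  qed
  have cdf: "cdf M x = (LINT y|lborel. indicator {..x} y * w y)" for x
    unfolding cdf_def measure_def
    by (subst emeasure_M) (auto intro!: enn2real_ennreal integral_nonneg_AE simp: w_nonneg)
  have delay_cdf: "delay_cdf q p x = q + cdf M x" for x
    by (simp add: delay_cdf_eq cdf)
  have "interval_measure (delay_cdf q p) = M"
  proof (rule measure_eqI_generator_eq[where \<Omega> = UNIV])
    fix X assume "X \<in> range (\<lambda>(a, b). {a<..b::real})"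
    then obtain a b where X: "X = {a<..b}" by auto
    show "emeasure (interval_measure (delay_cdf q p)) X = emeasure M X"
    proof (cases "a < b")
      case True
      have "emeasure (interval_measure (delay_cdf q p)) X = ennreal (cdf M b - cdf M a)"
        unfolding X using True M.cdf_nondecreasing M.cdf_is_right_cont
        by (subst emeasure_interval_measure_Ioc)
           (auto simp: delay_cdf[abs_def] intro!: continuous_intros)
      also have "\<dots> = emeasure M X"
        unfolding X using M.cdf_diff_eq[OF True] by (simp add: M.emeasure_eq_measure)
      finally show ?thesis .
    qed (simp add: X)
  next
    show "(\<Union>i. {- real (i::nat)<..real i}) = UNIV" by (rule UN_Ioc_eq_UNIV)
    fix n :: nat show "emeasure (interval_measure (delay_cdf q p)) {- real n<..real n} \<noteq> \<infinity>"
      using M.cdf_nondecreasing M.cdf_is_right_cont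
      by (subst emeasure_interval_measure_Ioc)
         (auto simp: delay_cdf[abs_def] intro!: continuous_intros)
  qed (auto simp: Int_stable_def borel_sigma_sets_Ioc M.M_is_borel)
  then show ?thesis by (simp add: M_def)
qed

lemma delay_quantile_eq:
  "delay_quantile q p (\<rho> + q) = Inf {t. t < \<infinity> \<and> \<rho> \<le> hit_ratio p t}"
proof -
  have "{ennreal x |x. 0 \<le> x \<and> \<rho> + q \<le> delay_cdf q p x} = {t. t < \<infinity> \<and> \<rho> \<le> hit_ratio p t}"
  proof (intro set_eqI iffI)
    fix t assume "t \<in> {t. t < \<infinity> \<and> \<rho> \<le> hit_ratio p t}"
    then show "t \<in> {ennreal x |x. 0 \<le> x \<and> \<rho> + q \<le> delay_cdf q p x}"
      by (cases t) (auto simp: delay_cdf_eq hit_ratio_ennreal)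
  qed (auto simp: delay_cdf_eq hit_ratio_ennreal)
  then show ?thesis by (simp add: delay_quantile_def)
qed

lemma delay_quantile_le: "\<rho> \<le> hit_ratio p t \<Longrightarrow> delay_quantile q p (\<rho> + q) \<le> t"
  unfolding delay_quantile_eq by (cases "t = \<infinity>") (auto simp: less_top intro: Inf_lower)

text \<open>Continuity excludes both strict inequalities at \<open>T\<close>. If the hit ratio
  exceeded \<open>\<rho>\<close>, then \<open>T > 0\<close> and some earlier time would still reach
  \<open>\<rho>\<close>. If it fell short at a finite \<open>T\<close>, so would all times slightly
  later, and the infimum would be larger.\<close>

lemma hit_ratio_delay_quantile:
  assumes "0 < \<rho>" "\<rho> \<le> 1 - q"
  shows "hit_ratio p (delay_quantile q p (\<rho> + q)) = \<rho>"
proof (rule antisym)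
  define T where "T = delay_quantile q p (\<rho> + q)"
  show "hit_ratio p T \<le> \<rho>"
  proof (rule ccontr)
    assume *: "\<not> hit_ratio p T \<le> \<rho>"
    then have "0 < T"
      using assms hit_ratio_zero by (cases "T = 0") (auto simp: zero_less_iff_neq_zero)
    have "open {t. \<rho> < hit_ratio p t}"
      by (intro open_Collect_less hit_ratio_continuous continuous_on_const)
    then obtain b where b: "b < T" "{b<..T} \<subseteq> {t. \<rho> < hit_ratio p t}"
      using open_left[OF _ _ \<open>0 < T\<close>] * by (auto simp: not_le)
    then obtain t where "b < t" "t < T"
      using dense by blast
    then show False
      using b delay_quantile_le[of \<rho> t] by (force simp: T_def)
  qed
  show "\<rho> \<le> hit_ratio p T"
  proof (cases "T = \<infinity>")
    case True
    then show ?thesis using assms hit_ratio_top by simp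
  next
    case False
    show ?thesis
    proof (rule ccontr)
      assume *: "\<not> \<rho> \<le> hit_ratio p T"
      have "open {t. hit_ratio p t < \<rho>}"
        by (intro open_Collect_less hit_ratio_continuous continuous_on_const)
      then obtain b where b: "T < b" "{T..<b} \<subseteq> {t. hit_ratio p t < \<rho>}"
        using open_right[of _ T \<infinity>] * False by (auto simp: not_le less_top)
      have "b \<le> T"
        unfolding T_def delay_quantile_eq
      proof (rule Inf_greatest)
        fix t assume t: "t \<in> {t. t < \<infinity> \<and> \<rho> \<le> hit_ratio p t}"
        then have "T \<le> t" using delay_quantile_le by (simp add: T_def)
        with t b show "b \<le> t" by (force simp: not_le[symmetric])
      qed
      with b show False by simp
    qed
  qed
qed

lemma delay_quantile_finite:
  assumes "0 < \<rho>" "\<rho> < 1 - q"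
  shows "delay_quantile q p (\<rho> + q) < \<infinity>"
proof -
  have "delay_quantile q p (\<rho> + q) \<noteq> \<infinity>"
    using hit_ratio_delay_quantile[of \<rho>] hit_ratio_top assms by auto
  then show ?thesis by (simp add: less_top)
qed

text \<open>The Stieltjes integral is one against the density, and \<open>1 - \<rho>\<close> is the
  probability of no request up to the quantile, whose hit ratio is exactly
  \<open>\<rho>\<close>.\<close>

lemma static_rate_cost_eq:
  assumes "0 < \<rho>" "\<rho> \<le> 1 - q"
  shows "static_rate_cost q p \<rho> = caching_time q p (delay_quantile q p (\<rho> + q))"
proof (cases "delay_quantile q p (\<rho> + q)")
  case (real a)
  have "(LINT x:{0..a}|interval_measure (delay_cdf q p). x) =
      (LINT x|density lborel (\<lambda>x. ennreal (w x)). indicator {0..a} x * x)"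
    unfolding interval_measure_delay_cdf set_lebesgue_integral_def by simp
  also have "\<dots> = (LINT x|lborel. w x *\<^sub>R (indicator {0..a} x * x))"
    by (intro integral_density) (auto simp: w_nonneg)
  also have "\<dots> = (LINT x|lborel. x * (indicator {..a} x * w x))"
    by (intro Bochner_Integration.integral_cong) (auto simp: w_def indicator_def)
  also have "\<dots> = (LINT x:{0..a}|lborel. x * p x)"
    by (rule truncated_integral[symmetric])
  finally have "(LINT x:{0..a}|interval_measure (delay_cdf q p). x) = (LINT x:{0..a}|lborel. x * p x)" .
  moreover have "q + (LINT x:{a..}|lborel. p x) = 1 - \<rho>"
    using tail_integral[of a] hit_ratio_delay_quantile[OF assms] real by simp
  ultimately show ?thesis
    using real by (simp add: static_rate_cost_def caching_time_ennreal caching_time_real_def mult.commute)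
qed (simp add: static_rate_cost_def)

section \<open>Randomized policies and the lower bound\<close>

lemma hit_ratio_measurable [measurable]: "hit_ratio p \<in> borel_measurable borel"
  by (rule borel_measurable_continuous_onI[OF hit_ratio_continuous])

lemma caching_time_measurable [measurable]: "caching_time q p \<in> borel_measurable borel"
  by (rule borel_measurable_continuous_onI[OF caching_time_continuous])

text \<open>A Bernoulli coin selects \<open>a\<close> or \<open>b\<close>; \<open>u = 1\<close>
  gives the static policies.\<close>

lemma two_point_policy:
  assumes "0 \<le> u" "u \<le> 1"
  obtains f where "f \<in> policies"
    "policy_hit_ratio p f = u * hit_ratio p a + (1 - u) * hit_ratio p b"
    "policy_caching_time q p f = ennreal u * caching_time q p a + ennreal (1 - u) * caching_time q p b"
proof
  let ?f = "distr (measure_pmf (bernoulli_pmf u)) borel (\<lambda>z. if z then a else b)"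
  show "?f \<in> policies"
    unfolding policies_def by (auto intro!: prob_space.prob_space_distr prob_space_measure_pmf)
  show "policy_hit_ratio p ?f = u * hit_ratio p a + (1 - u) * hit_ratio p b"
    unfolding policy_hit_ratio_def using assms by (subst integral_distr) auto
  show "policy_caching_time q p ?f =
      ennreal u * caching_time q p a + ennreal (1 - u) * caching_time q p b"
    unfolding policy_caching_time_def using assms
    by (subst nn_integral_distr) (auto simp: mult.commute)
qed

text \<open>In the interior a supporting line is integrated. At \<open>r = 1 - q\<close> the
  function \<open>g\<close> may jump or be infinite, so the extremality of the hit ratio is used
  instead.\<close>

lemma policy_lower_bound:
  assumes f: "f \<in> policies" "policy_hit_ratio p f = r"
    and g: "ereal_convex_on {0..1 - q} g" "g 0 = 0"
      "\<And>\<rho>. \<rho> \<in> {0<..1 - q} \<Longrightarrow> g \<rho> \<le> enn2ereal (static_rate_cost q p \<rho>)"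
  shows "g r \<le> enn2ereal (policy_caching_time q p f)"
proof -
  interpret prob_space f using f by (simp add: policies_def)
  have [measurable_cong]: "sets f = sets borel" using f by (simp add: policies_def)
  have int: "integrable f (hit_ratio p)"
    by (rule integrable_const_bound[where B = "1 - q"])
       (auto simp: hit_ratio_nonneg hit_ratio_le)
  have r: "r = (LINT t|f. hit_ratio p t)"
    using f by (simp add: policy_hit_ratio_def)
  have "0 \<le> r"
    unfolding r by (intro integral_nonneg_AE) (simp add: hit_ratio_nonneg)
  have "r \<le> (LINT t|f. 1 - q)"
    unfolding r by (intro integral_mono int) (auto simp: hit_ratio_le)
  then have "r \<le> 1 - q" by (simp add: prob_space)
  \<comment> \<open>The quantile at level \<open>hit_ratio p t\<close> is at most \<open>t\<close>,
    so the static cost is at most the caching time of \<open>t\<close>.\<close>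
  have pointwise: "g (hit_ratio p t) \<le> enn2ereal (caching_time q p t)" for t
  proof (cases "hit_ratio p t = 0")
    case False
    then have pos: "0 < hit_ratio p t"
      using hit_ratio_nonneg[of t] by linarith
    then have "g (hit_ratio p t) \<le> enn2ereal (static_rate_cost q p (hit_ratio p t))"
      using g(3) hit_ratio_le by simp
    also have "static_rate_cost q p (hit_ratio p t) \<le> caching_time q p t"
      using pos hit_ratio_le[of t] monoD[OF caching_time_mono delay_quantile_le[OF order_refl]]
      by (simp add: static_rate_cost_eq)
    finally show ?thesis by (simp add: less_eq_ennreal.rep_eq)
  qed (use g in simp)
  consider "r = 0" | "0 < r" "r < 1 - q" | "r = 1 - q"
    using \<open>0 \<le> r\<close> \<open>r \<le> 1 - q\<close> by linarith
  then show ?thesis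
  proof cases
    case 1
    then show ?thesis using g(2) by simp
  next
    case 2
    have fin: "g x < \<infinity>" if "0 \<le> x" "x < 1 - q" for x
    proof (cases "x = 0")
      case False
      then have "static_rate_cost q p x < \<infinity>"
        using that caching_time_finite[OF delay_quantile_finite[of x]] by (simp add: static_rate_cost_eq)
      then show ?thesis
        using g(3)[of x] that False by (cases "static_rate_cost q p x") (auto simp: enn2ereal_ennreal)
    qed (use g in simp)
    obtain c where c: "\<And>x. x \<in> {0..1 - q} \<Longrightarrow> ereal (real_of_ereal (g r) + c * (x - r)) \<le> g x"
      using ereal_convex_on_supporting_line[OF g(1) 2 fin] by blast
    define h where "h t = real_of_ereal (g r) + c * (hit_ratio p t - r)" for t
    have "ennreal (h t) \<le> caching_time q p t" for t
    proof -
      have "ereal (h t) \<le> enn2ereal (caching_time q p t)"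
        using c[of "hit_ratio p t"] pointwise[of t] hit_ratio_nonneg hit_ratio_le
        by (auto simp: h_def)
      from e2ennreal_mono[OF this] show ?thesis by simp
    qed
    moreover have "integrable f h"
      unfolding h_def using int by simp
    ultimately have "ennreal (LINT t|f. h t) \<le> policy_caching_time q p f"
      unfolding policy_caching_time_def by (intro integral_le_nn_integral)
    moreover have "(LINT t|f. h t) = real_of_ereal (g r)"
      unfolding h_def using int r by (simp add: prob_space)
    ultimately have "enn2ereal (ennreal (real_of_ereal (g r))) \<le> enn2ereal (policy_caching_time q p f)"
      by (simp add: less_eq_ennreal.rep_eq)
    moreover have "g r = ereal (real_of_ereal (g r))"
      using fin[of r] g(1) 2 unfolding ereal_convex_on_def by (cases "g r") auto
    \<comment> \<open>A negative \<open>g r\<close> is truncated to \<open>0\<close>, which only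
      increases it.\<close>
    then have "g r \<le> enn2ereal (ennreal (real_of_ereal (g r)))"
      by (cases "g r"; cases "0 \<le> real_of_ereal (g r)")
         (auto simp: enn2ereal_ennreal ennreal_neg zero_ennreal.rep_eq)
    ultimately show ?thesis by order
  next
    case 3
    \<comment> \<open>A mean equal to the maximal hit ratio forces that ratio almost surely.\<close>
    have "(LINT t|f. (1 - q) - hit_ratio p t) = 0"
      using int r 3 by (simp add: prob_space)
    then have "AE t in f. (1 - q) - hit_ratio p t = 0"
      using integral_nonneg_eq_0_iff_AE[of f "\<lambda>t. (1 - q) - hit_ratio p t"] int hit_ratio_le by simp
    then have "AE t in f. e2ennreal (g r) \<le> caching_time q p t"
    proof eventually_elim
      case (elim t)
      then have "hit_ratio p t = r" using 3 by simp
      then show ?case using e2ennreal_mono[OF pointwise[of t]] by simp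
    qed
    then have "(\<integral>\<^sup>+ t. e2ennreal (g r) \<partial>f) \<le> policy_caching_time q p f"
      unfolding policy_caching_time_def by (rule nn_integral_mono_AE)
    then have "enn2ereal (e2ennreal (g r)) \<le> enn2ereal (policy_caching_time q p f)"
      by (simp add: emeasure_space_1 less_eq_ennreal.rep_eq)
    moreover have "g r \<le> enn2ereal (e2ennreal (g r))"
      by (cases "0 \<le> g r") (auto simp: enn2ereal_e2ennreal e2ennreal_neg zero_ennreal.rep_eq)
    ultimately show ?thesis by order
  qed
qed

section \<open>Attainment of the envelope\<close>

text \<open>A duality certificate: \<open>g r\<close> is at most the envelope, which by the lower
  bound is at most the cost of \<open>f\<close>; the assumption \<open>le\<close> closes the
  chain.\<close>

lemma minimum_cost_if_attained:
  assumes f: "f \<in> policies" "policy_hit_ratio p f = r"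
    and r: "r \<in> {0..1 - q}"
    and g: "ereal_convex_on {0..1 - q} g" "g 0 = 0"
      "\<And>\<rho>. \<rho> \<in> {0<..1 - q} \<Longrightarrow> g \<rho> \<le> enn2ereal (static_rate_cost q p \<rho>)"
    and le: "enn2ereal (policy_caching_time q p f) \<le> g r"
  shows "enn2ereal (policy_caching_time q p f) = convex_rate_cost q p r"
proof (rule antisym)
  have "g r \<le> convex_rate_cost q p r"
    unfolding convex_rate_cost_def using g by (intro Sup_upper) auto
  with le show "enn2ereal (policy_caching_time q p f) \<le> convex_rate_cost q p r" by order
  show "convex_rate_cost q p r \<le> enn2ereal (policy_caching_time q p f)"
    unfolding convex_rate_cost_def using policy_lower_bound[OF f] by (intro Sup_least) auto
qed

lemma minimum_cost_attained_interior:
  assumes r: "0 < r" "r < 1 - q"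
  shows "\<exists>f\<in>policies. policy_hit_ratio p f = r \<and>
    enn2ereal (policy_caching_time q p f) = convex_rate_cost q p r"
proof -
  let ?R = "hit_ratio p" and ?S = "caching_time q p"
  \<comment> \<open>A level strictly between \<open>r\<close> and \<open>1 - q\<close> has a finite
    quantile, hence finite cost; time \<open>\<infinity>\<close> might not. Time \<open>0\<close>
    serves as the lower comparison point.\<close>
  define \<rho> where "\<rho> = (r + (1 - q)) / 2"
  have \<rho>: "r < \<rho>" "0 < \<rho>" "\<rho> < 1 - q" using r by (auto simp: \<rho>_def)
  then have t1: "?S (delay_quantile q p (\<rho> + q)) < \<infinity>" "r < ?R (delay_quantile q p (\<rho> + q))"
    using caching_time_finite[OF delay_quantile_finite[of \<rho>]] hit_ratio_delay_quantile[of \<rho>] by auto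
  obtain c a b where ab: "lagrangian_minimizer ?R ?S c a" "lagrangian_minimizer ?R ?S c b"
      "?R a \<le> r" "r \<le> ?R b"
    using bracketing_lagrangian_minimizers[OF hit_ratio_continuous caching_time_continuous _ _ t1, of 0]
      r by (auto simp: caching_time_zero hit_ratio_zero)
  have M: "enn2ereal (?S t) \<le> enn2ereal (?S u) + ereal (c * (?R t - ?R u))"
    if "t \<in> {a, b}" for t u
    using ab that by (auto simp: lagrangian_minimizer_def)
  have fin: "?S t < \<infinity>" if "t \<in> {a, b}" for t
    using M[OF that, of 0] by (cases "?S t") (auto simp: caching_time_zero)
  obtain sa sb where s: "?S a = ennreal sa" "0 \<le> sa" "?S b = ennreal sb" "0 \<le> sb"
    using fin[of a] fin[of b] by (cases "?S a"; cases "?S b") auto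
  \<comment> \<open>The common minimum of \<open>\<sigma> - c \<rho>\<close>, attained at both
    \<open>a\<close> and \<open>b\<close>. Time \<open>0\<close>, with zero cost and zero hit ratio,
    shows \<open>L \<le> 0\<close>.\<close>
  define L where "L = sa - c * ?R a"
  have L: "L = sb - c * ?R b"
    using M[of a b] M[of b a] s by (simp add: L_def enn2ereal_ennreal algebra_simps)
  have "L \<le> 0"
    using M[of a 0] s by (simp add: L_def enn2ereal_ennreal caching_time_zero hit_ratio_zero zero_ennreal.rep_eq)
  \<comment> \<open>The weight that makes the mean hit ratio \<open>r\<close>. If both ratios
    coincide they equal \<open>r\<close>, and \<open>1\<close> is chosen.\<close>
  define u where "u = (if ?R a = ?R b then 1 else (?R b - r) / (?R b - ?R a))"
  have u: "0 \<le> u" "u \<le> 1"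
    using ab by (auto simp: u_def divide_simps)
  have ur: "u * ?R a + (1 - u) * ?R b = r"
  proof (cases "?R a = ?R b")
    case True
    then show ?thesis using ab by (simp add: u_def)
  next
    case False
    have "u * ?R a + (1 - u) * ?R b = ?R b - u * (?R b - ?R a)"
      by (simp add: algebra_simps)
    then show ?thesis using False by (simp add: u_def)
  qed
  obtain f where f: "f \<in> policies" "policy_hit_ratio p f = u * ?R a + (1 - u) * ?R b"
      "policy_caching_time q p f = ennreal u * ?S a + ennreal (1 - u) * ?S b"
    using two_point_policy[OF u] by blast
  have "u * sa + (1 - u) * sb = L + c * (u * ?R a + (1 - u) * ?R b)"
  proof -
    have "sa = L + c * ?R a" "sb = L + c * ?R b"
      by (simp add: L_def) (simp add: L)
    then show ?thesis by (simp add: algebra_simps)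
  qed
  moreover have "policy_caching_time q p f = ennreal (u * sa + (1 - u) * sb)"
    using f(3) s u by (simp add: ennreal_mult ennreal_plus)
  moreover have "0 \<le> u * sa + (1 - u) * sb"
    using s u by simp
  ultimately have cost: "enn2ereal (policy_caching_time q p f) = ereal (L + c * r)"
    using ur by (simp add: enn2ereal_ennreal)
  have "enn2ereal (policy_caching_time q p f) = convex_rate_cost q p r"
  proof (rule minimum_cost_if_attained[where g = "\<lambda>x. if x = 0 then 0 else ereal (L + c * x)"])
    show "ereal_convex_on {0..1 - q} (\<lambda>x. if x = 0 then 0 else ereal (L + c * x))"
      using \<open>L \<le> 0\<close> by (rule affine_minorant_convex)
    fix x assume x: "x \<in> {0<..1 - q}"
    let ?t = "delay_quantile q p (x + q)"
    \<comment> \<open>Minimality of \<open>a\<close> against the quantile time of level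
      \<open>x\<close>.\<close>
    have "ereal (L + c * x) \<le> enn2ereal (?S ?t)"
      using M[of a ?t] s x hit_ratio_delay_quantile[of x]
      by (cases "?S ?t") (auto simp: L_def enn2ereal_ennreal algebra_simps)
    then show "(if x = 0 then 0 else ereal (L + c * x)) \<le> enn2ereal (static_rate_cost q p x)"
      using x by (simp add: static_rate_cost_eq)
  qed (use r f ur cost in auto)
  with f ur show ?thesis by auto
qed

lemma minimum_cost_attained:
  assumes r: "r \<in> {0..1 - q}"
  shows "\<exists>f\<in>policies. policy_hit_ratio p f = r \<and>
    enn2ereal (policy_caching_time q p f) = convex_rate_cost q p r"
proof -
  consider "r = 0" | "0 < r" "r < 1 - q" | "r = 1 - q"
    using r by fastforce
  then show ?thesis
  proof cases
    case 1
    obtain f where f: "f \<in> policies" "policy_hit_ratio p f = 0" "policy_caching_time q p f = 0"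
      using two_point_policy[of 1 0 0] by (auto simp: hit_ratio_zero caching_time_zero)
    have "enn2ereal (policy_caching_time q p f) = convex_rate_cost q p r"
      \<comment> \<open>The zero function serves as certificate.\<close>
      by (rule minimum_cost_if_attained[where g = "\<lambda>x. if x = 0 then 0 else ereal (0 + 0 * x)"])
         (use f r 1 affine_minorant_convex[of 0 "1 - q" 0] in \<open>auto simp: zero_ereal_def[symmetric] zero_ennreal.rep_eq\<close>)
    then show ?thesis using f 1 by auto
  next
    case 2
    then show ?thesis by (rule minimum_cost_attained_interior)
  next
    case 3
    let ?t = "delay_quantile q p (r + q)"
    have t: "hit_ratio p ?t = r" "static_rate_cost q p r = caching_time q p ?t"
      using 3 q hit_ratio_delay_quantile[of r] static_rate_cost_eq[of r] by simp_all
    obtain f where f: "f \<in> policies" "policy_hit_ratio p f = r"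
        "policy_caching_time q p f = static_rate_cost q p r"
      using two_point_policy[of 1 ?t ?t] t by auto
    \<comment> \<open>The jump at the endpoint matches the static cost even if that is infinite;
      \<open>q < 1\<close> keeps the value at \<open>0\<close> equal to \<open>0\<close>.\<close>
    have "enn2ereal (policy_caching_time q p f) = convex_rate_cost q p r"
      by (rule minimum_cost_if_attained[where
            g = "\<lambda>x. if x = 1 - q then enn2ereal (static_rate_cost q p r) else 0"])
         (use f r 3 q endpoint_jump_convex[of "enn2ereal (static_rate_cost q p r)" "1 - q"] in auto)
    then show ?thesis using f by auto
  qed
qed

end

theorem theorem2:
  fixes q r :: real and p :: "real \<Rightarrow> real"
  assumes "0 \<le> q" and "q < 1"
    and "\<And>x. 0 \<le> x \<Longrightarrow> 0 \<le> p x"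
    and "set_integrable lborel {0..} p"
    and "q + (LINT x:{0..}|lborel. p x) = 1"
    and "r \<in> {0..1 - q}"
  shows "(\<exists>f\<in>policies. policy_hit_ratio p f = r \<and>
            enn2ereal (policy_caching_time q p f) = convex_rate_cost q p r) \<and>
         (\<forall>f\<in>policies. policy_hit_ratio p f = r \<longrightarrow>
            convex_rate_cost q p r \<le> enn2ereal (policy_caching_time q p f))"
proof -
  interpret request_delay q p
    using assms by unfold_locales auto
  show ?thesis
  proof (intro conjI ballI impI)
    fix f assume "f \<in> policies" "policy_hit_ratio p f = r"
    then show "convex_rate_cost q p r \<le> enn2ereal (policy_caching_time q p f)"
      unfolding convex_rate_cost_def using policy_lower_bound by (intro Sup_least) auto
  qed (rule minimum_cost_attained[OF assms(6)])
qed

end
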